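(* Let $C=\lnot A_1\lor\dots\lor\lnot A_n\lor D$, $C_1=B_1\lor D_1,\dots,C_n=B_n\lor D_n$ be query pair clauses for a query pair $(A_1,\dots,A_n;B_1,\dots,B_n)$, and let $R$ be the resolvent of an application of Res to them. Then there is no variable depth growth: the depth of $R$ does not exceed the maximum of the depths of the premises $C,C_1,\dots,C_n$.
   Context: Terms over constants, function symbols and variables; $var(E)$ is the set of variables of $E$. Variable depth: $vdp(t)=-1$ if $t$ is ground, $0$ if $t$ is a variable, $1+\max_i vdp(u_i)$ if $t=f(u_1,\dots,u_n)$ is non-ground. A term is flat if $vdp(t)\le0$, simple if $vdp(t)\le1$; atoms/literals/clauses are flat (simple) if all their terms are. The depth of a clause is the maximal variable depth of its terms. A non-ground compound literal is one containing a non-ground compound term. A compound term $t$ is weakly covering if $var(s)=var(t)$ for each non-ground compound subterm $s$ of $t$; a literal $L$ is weakly covering if each argument is ground, a variable, or a weakly covering term $t$ with $var(t)=var(L)$. Query pair: sequences of atoms $\overline{A}=A_1,\dots,A_n$ and weakly covering atoms $\overline B=B_1,\dots,B_n$ such that (1) $\overline A$ is flat and non-ground, $\overline B$ is simple; (2) each $B_i$ is a non-ground compound literal or ground; (3) $var(\overline A)\cap var(\overline B)=\emptyset$ and the $B_i$ are pairwise variable-disjoint; (4) there is a simultaneous mgu $\sigma$ with $A_i\sigma=B_i\sigma$ for all $i$. Query pair clauses: $C=\lnot A_1\lor\dots\lor\lnot A_n\lor D$ with $D$ flat (main premise), and $C_i=B_i\lor D_i$ with $D_i$ simple (side premises). Top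 variable: with $\sigma$ as in (4), $x\in var(\overline A)$ is a top variable if $vdp(x\sigma)\ge vdp(y\sigma)$ for every $y\in var(\overline A)$. Res: reorder so that $A_1,\dots,A_t$ ($1\le t\le n$) are exactly the atoms among $A_1,\dots,A_n$ containing a top variable; let $\sigma$ be an mgu with $A_i\sigma=B_i\sigma$ for $1\le i\le t$; Res derives from $C,C_1,\dots,C_t$ the resolvent $(D_1\lor\dots\lor D_t\lor\lnot A_{t+1}\lor\dots\lor\lnot A_n\lor D)\sigma$.
   Formalization: The main premise C is assumed to share no variables with the side premises C_i (premises renamed apart); otherwise C = ¬P(x), C_1 = P(f(y)) ∨ Q(g(x)) gives the resolvent Q(g(f(y))) of depth 2, while the premises have depth at most 1. *)

theory Defs
  imports Main "HOL-Library.Multiset"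
begin

text \<open>Constants are function symbols applied to the empty list.\<close>

datatype (fun_syms: 'f, vars: 'v) trm = Var 'v | Fun 'f "('f, 'v) trm list"

datatype ('p, 'f, 'v) atom = Atom (pred_sym: 'p) (args: "('f, 'v) trm list")

datatype 'a literal = Pos (atm: 'a) | Neg (atm: 'a)

type_synonym ('p, 'f, 'v) clause = "('p, 'f, 'v) atom literal multiset"
type_synonym ('f, 'v) subst = "'v \<Rightarrow> ('f, 'v) trm"

definition vars_atom :: "('p, 'f, 'v) atom \<Rightarrow> 'v set" where
  "vars_atom A = (\<Union>t\<in>set (args A). vars t)"

definition vars_atoms :: "('p, 'f, 'v) atom list \<Rightarrow> 'v set" where
  "vars_atoms As = (\<Union>A\<in>set As. vars_atom A)"

definition vars_clause :: "('p, 'f, 'v) clause \<Rightarrow> 'v set" where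
  "vars_clause C = (\<Union>L\<in>set_mset C. vars_atom (atm L))"

definition terms_clause :: "('p, 'f, 'v) clause \<Rightarrow> ('f, 'v) trm set" where
  "terms_clause C = (\<Union>L\<in>set_mset C. set (args (atm L)))"

definition ground :: "('f, 'v) trm \<Rightarrow> bool" where
  "ground t \<longleftrightarrow> vars t = {}"

definition ground_atom :: "('p, 'f, 'v) atom \<Rightarrow> bool" where
  "ground_atom A \<longleftrightarrow> vars_atom A = {}"

primrec compound :: "('f, 'v) trm \<Rightarrow> bool" where
  "compound (Var x) \<longleftrightarrow> False"
| "compound (Fun f ts) \<longleftrightarrow> ts \<noteq> []"

primrec is_variable :: "('f, 'v) trm \<Rightarrow> bool" where
  "is_variable (Var x) \<longleftrightarrow> True"
| "is_variable (Fun f ts) \<longleftrightarrow> False"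

primrec subterms :: "('f, 'v) trm \<Rightarrow> ('f, 'v) trm set" where
  "subterms (Var x) = {Var x}"
| "subterms (Fun f ts) = insert (Fun f ts) (\<Union> (set (map subterms ts)))"

primrec vdp :: "('f, 'v) trm \<Rightarrow> int" where
  "vdp (Var x) = 0"
| "vdp (Fun f ts) = (if ground (Fun f ts) then -1 else 1 + Max (set (map vdp ts)))"

definition flat_term :: "('f, 'v) trm \<Rightarrow> bool" where
  "flat_term t \<longleftrightarrow> vdp t \<le> 0"

definition simple_term :: "('f, 'v) trm \<Rightarrow> bool" where
  "simple_term t \<longleftrightarrow> vdp t \<le> 1"

definition flat_atom :: "('p, 'f, 'v) atom \<Rightarrow> bool" where
  "flat_atom A \<longleftrightarrow> (\<forall>t\<in>set (args A). flat_term t)"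

definition simple_atom :: "('p, 'f, 'v) atom \<Rightarrow> bool" where
  "simple_atom A \<longleftrightarrow> (\<forall>t\<in>set (args A). simple_term t)"

definition flat_clause :: "('p, 'f, 'v) clause \<Rightarrow> bool" where
  "flat_clause C \<longleftrightarrow> (\<forall>t\<in>terms_clause C. flat_term t)"

definition simple_clause :: "('p, 'f, 'v) clause \<Rightarrow> bool" where
  "simple_clause C \<longleftrightarrow> (\<forall>t\<in>terms_clause C. simple_term t)"

text \<open>A clause without any term, in particular the empty clause, gets the depth of a
  ground clause.\<close>

definition depth_clause :: "('p, 'f, 'v) clause \<Rightarrow> int" where
  "depth_clause C = (if terms_clause C = {} then -1 else Max (vdp ` terms_clause C))"

definition nonground_compound_atom :: "('p, 'f, 'v) atom \<Rightarrow> bool" where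
  "nonground_compound_atom A \<longleftrightarrow>
     (\<exists>t\<in>set (args A). \<exists>s\<in>subterms t. \<not> ground s \<and> compound s)"

definition weakly_covering_term :: "('f, 'v) trm \<Rightarrow> bool" where
  "weakly_covering_term t \<longleftrightarrow> compound t \<and>
     (\<forall>s\<in>subterms t. \<not> ground s \<and> compound s \<longrightarrow> vars s = vars t)"

definition weakly_covering_atom :: "('p, 'f, 'v) atom \<Rightarrow> bool" where
  "weakly_covering_atom A \<longleftrightarrow>
     (\<forall>t\<in>set (args A). ground t \<or> is_variable t \<or>
        weakly_covering_term t \<and> vars t = vars_atom A)"

primrec subst_term :: "('f, 'v) subst \<Rightarrow> ('f, 'v) trm \<Rightarrow> ('f, 'v) trm" where
  "subst_term \<sigma> (Var x) = \<sigma> x"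
| "subst_term \<sigma> (Fun f ts) = Fun f (map (subst_term \<sigma>) ts)"

primrec subst_atom :: "('f, 'v) subst \<Rightarrow> ('p, 'f, 'v) atom \<Rightarrow> ('p, 'f, 'v) atom" where
  "subst_atom \<sigma> (Atom p ts) = Atom p (map (subst_term \<sigma>) ts)"

definition subst_clause :: "('f, 'v) subst \<Rightarrow> ('p, 'f, 'v) clause \<Rightarrow> ('p, 'f, 'v) clause" where
  "subst_clause \<sigma> C = image_mset (map_literal (subst_atom \<sigma>)) C"

definition unifier ::
  "('f, 'v) subst \<Rightarrow> (('p, 'f, 'v) atom \<times> ('p, 'f, 'v) atom) set \<Rightarrow> bool" where
  "unifier \<sigma> E \<longleftrightarrow> (\<forall>(A, B)\<in>E. subst_atom \<sigma> A = subst_atom \<sigma> B)"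

definition is_mgu ::
  "('f, 'v) subst \<Rightarrow> (('p, 'f, 'v) atom \<times> ('p, 'f, 'v) atom) set \<Rightarrow> bool" where
  "is_mgu \<sigma> E \<longleftrightarrow> unifier \<sigma> E \<and>
     (\<forall>\<tau>. unifier \<tau> E \<longrightarrow> (\<exists>\<delta>. \<forall>x. \<tau> x = subst_term \<delta> (\<sigma> x)))"

text \<open>Flatness of a sequence is required of every member, whereas a sequence is non-ground
  as soon as some variable occurs in it.\<close>

definition query_pair ::
  "('p, 'f, 'v) atom list \<Rightarrow> ('p, 'f, 'v) atom list \<Rightarrow> bool" where
  "query_pair As Bs \<longleftrightarrow>
     length As = length Bs \<and>
     (\<forall>B\<in>set Bs. weakly_covering_atom B) \<and>
     (\<forall>A\<in>set As. flat_atom A) \<and> vars_atoms As \<noteq> {} \<and>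
     (\<forall>B\<in>set Bs. simple_atom B) \<and>
     (\<forall>B\<in>set Bs. nonground_compound_atom B \<or> ground_atom B) \<and>
     vars_atoms As \<inter> vars_atoms Bs = {} \<and>
     (\<forall>i<length Bs. \<forall>j<length Bs. i \<noteq> j \<longrightarrow> vars_atom (Bs ! i) \<inter> vars_atom (Bs ! j) = {}) \<and>
     (\<exists>\<sigma>. is_mgu \<sigma> (set (zip As Bs)))"

definition main_premise ::
  "('p, 'f, 'v) atom list \<Rightarrow> ('p, 'f, 'v) clause \<Rightarrow> ('p, 'f, 'v) clause" where
  "main_premise As D = mset (map Neg As) + D"

definition side_premise ::
  "('p, 'f, 'v) atom \<Rightarrow> ('p, 'f, 'v) clause \<Rightarrow> ('p, 'f, 'v) clause" where
  "side_premise B D = {#Pos B#} + D"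

definition query_pair_clauses ::
  "('p, 'f, 'v) atom list \<Rightarrow> ('p, 'f, 'v) clause \<Rightarrow>
   ('p, 'f, 'v) atom list \<Rightarrow> ('p, 'f, 'v) clause list \<Rightarrow>
   ('p, 'f, 'v) clause \<Rightarrow> ('p, 'f, 'v) clause list \<Rightarrow> bool" where
  "query_pair_clauses As D Bs Ds C Cs \<longleftrightarrow>
     query_pair As Bs \<and> length Ds = length Bs \<and>
     flat_clause D \<and> (\<forall>D'\<in>set Ds. simple_clause D') \<and>
     C = main_premise As D \<and> Cs = map2 side_premise Bs Ds"

definition top_variable ::
  "('f, 'v) subst \<Rightarrow> ('p, 'f, 'v) atom list \<Rightarrow> 'v \<Rightarrow> bool" where
  "top_variable \<sigma> As x \<longleftrightarrow>
     x \<in> vars_atoms As \<and> (\<forall>y\<in>vars_atoms As. vdp (\<sigma> y) \<le> vdp (\<sigma> x))"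

text \<open>Instead of reordering the atoms, the rule works with the set of positions of the atoms
  that contain a top variable. The unifier \<open>\<sigma>\<close> of the whole query pair only
  determines the top variables; the resolvent is built with an mgu \<open>\<tau>\<close> of the selected
  pairs.\<close>

definition top_positions ::
  "('f, 'v) subst \<Rightarrow> ('p, 'f, 'v) atom list \<Rightarrow> nat set" where
  "top_positions \<sigma> As = {i. i < length As \<and> (\<exists>x\<in>vars_atom (As ! i). top_variable \<sigma> As x)}"

definition Res_resolvent ::
  "('p, 'f, 'v) atom list \<Rightarrow> ('p, 'f, 'v) clause \<Rightarrow>
   ('p, 'f, 'v) atom list \<Rightarrow> ('p, 'f, 'v) clause list \<Rightarrow> ('p, 'f, 'v) clause \<Rightarrow> bool" where
  "Res_resolvent As D Bs Ds R \<longleftrightarrow>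
     (\<exists>\<sigma> \<tau> T. is_mgu \<sigma> (set (zip As Bs)) \<and> T = top_positions \<sigma> As \<and>
        is_mgu \<tau> ((\<lambda>i. (As ! i, Bs ! i)) ` T) \<and>
        R = subst_clause \<tau>
              ((\<Sum>i\<in>T. Ds ! i) + {#Neg (As ! i). i \<in># mset_set ({..<length As} - T)#} + D))"

end

theory Submission
  imports Defs
begin

text \<open>If all variables of the main-premise atoms become ground under \<open>\<sigma>\<close>, then every non-ground atom
  is selected and \<open>\<tau>\<close> agrees with \<open>\<sigma>\<close> on the selected pairs. Otherwise, in every selected pair, the
  top variables face exactly the non-ground compound arguments of \<open>B\<^sub>i\<close>: such arguments contain all
  variables of \<open>B\<^sub>i\<close>, so their instances are strictly deeper than those of the variables of \<open>B\<^sub>i\<close>. All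
  remaining equations are between flat terms, hence \<open>\<tau>\<close> is flat on every variable except the top
  ones, on which its depth is at most 1, the depth of a selected \<open>B\<^sub>i\<close>.\<close>

section \<open>Variable depth of flat and simple terms\<close>

lemma vdp_ground: "ground t \<Longrightarrow> vdp t = -1"
  by (cases t) (auto simp: ground_def)

lemma vdp_nonground: "\<not> ground t \<Longrightarrow> 0 \<le> vdp t"
proof (induction t)
  case (Fun f ts)
  then obtain t where t: "t \<in> set ts" "\<not> ground t" by (auto simp: ground_def)
  then have "0 \<le> vdp t" using Fun.IH by blast
  also have "vdp t \<le> Max (set (map vdp ts))" using t by (intro Max_ge) auto
  finally show ?case using Fun.prems by auto
qed simp

lemma vdp_ge: "-1 \<le> vdp t"
  using vdp_ground[of t] vdp_nonground[of t] by force

lemma vdp_neg_iff: "vdp t < 0 \<longleftrightarrow> ground t"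
  using vdp_ground[of t] vdp_nonground[of t] by force

lemma vdp_arg:
  assumes "\<not> ground (Fun f ts)" "t \<in> set ts"
  shows "vdp t < vdp (Fun f ts)"
proof -
  have "vdp t \<le> Max (set (map vdp ts))" using assms by (intro Max_ge) auto
  moreover have "vdp (Fun f ts) = 1 + Max (set (map vdp ts))" using assms(1) by simp
  ultimately show ?thesis by linarith
qed

lemma vdp_Fun_le:
  assumes "\<And>t. t \<in> set ts \<Longrightarrow> vdp t \<le> k" "-1 \<le> k"
  shows "vdp (Fun f ts) \<le> 1 + k"
proof (cases "ground (Fun f ts)")
  case False
  then have "ts \<noteq> []" by (auto simp: ground_def)
  then have "Max (set (map vdp ts)) \<le> k" using assms by (subst Max_le_iff) auto
  then show ?thesis using False by simp
qed (use assms in \<open>simp add: vdp_ground\<close>)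

text \<open>A non-ground compound term has a non-ground argument, of depth at least 0, and so has
  depth at least 1 itself. Ground compound terms remain flat, since their depth is -1.\<close>

lemma flat_term_cases:
  assumes "flat_term t"
  obtains "ground t" | x where "t = Var x"
proof (cases t)
  case (Fun f ts)
  have "ground t"
  proof (rule ccontr)
    assume ng: "\<not> ground t"
    then obtain s where "s \<in> set ts" "\<not> ground s" using Fun by (auto simp: ground_def)
    then show False
      using vdp_arg[of f ts s] vdp_nonground[of s] ng Fun assms by (simp add: flat_term_def)
  qed
  then show ?thesis using that by blast
qed (use that in blast)

lemma simple_term_args_flat:
  assumes "simple_term (Fun f ts)" "t \<in> set ts"
  shows "flat_term t"
proof (cases "ground (Fun f ts)")
  case True
  then have "ground t" using assms by (auto simp: ground_def)
  then show ?thesis by (simp add: vdp_ground flat_term_def)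
next
  case False
  then show ?thesis using vdp_arg[OF False assms(2)] assms by (simp add: simple_term_def flat_term_def)
qed

text \<open>The arguments of a simple term are flat, so a variable can only occur in one by being
  that argument.\<close>

lemma simple_term_vars_arg:
  assumes "simple_term (Fun f ts)" "x \<in> vars (Fun f ts)"
  shows "Var x \<in> set ts"
proof -
  obtain t where t: "t \<in> set ts" "x \<in> vars t" using assms by auto
  from simple_term_args_flat[OF assms(1) t(1)] show ?thesis
    by (rule flat_term_cases) (use t in \<open>auto simp: ground_def\<close>)
qed

section \<open>Variable depth under substitution\<close>

lemma vars_subst_term: "vars (subst_term \<sigma> t) = (\<Union>x\<in>vars t. vars (\<sigma> x))"
  by (induction t) auto

lemma subst_term_cong: "(\<And>x. x \<in> vars t \<Longrightarrow> \<sigma> x = \<tau> x) \<Longrightarrow> subst_term \<sigma> t = subst_term \<tau> t"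
  by (induction t) auto

lemma subst_term_ground: "ground t \<Longrightarrow> subst_term \<sigma> t = t"
  by (induction t) (auto simp: ground_def map_idI)

lemma ground_subst_iff: "ground (subst_term \<sigma> t) \<longleftrightarrow> (\<forall>x\<in>vars t. ground (\<sigma> x))"
  by (auto simp: ground_def vars_subst_term)

lemma subst_eq_VarD: "subst_term \<delta> t = Var v \<Longrightarrow> \<exists>x. t = Var x"
  by (cases t) auto

text \<open>By induction on \<open>t\<close>: a variable has depth 0 and receives a value of depth
  at most 0, ground terms do not change, and a non-ground compound term passes the bound up from its
  arguments.\<close>

lemma vdp_subst_flat_le:
  assumes "\<And>x. x \<in> vars t \<Longrightarrow> vdp (\<tau> x) \<le> 0"
  shows "vdp (subst_term \<tau> t) \<le> vdp t"
  using assms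
proof (induction t)
  case (Fun f ts)
  show ?case
  proof (cases "ground (Fun f ts)")
    case True
    then show ?thesis by (metis order_refl subst_term_ground)
  next
    case False
    have le: "vdp s \<le> vdp (Fun f ts) - 1" if "s \<in> set (map (subst_term \<tau>) ts)" for s
    proof -
      from that obtain t where t: "t \<in> set ts" "s = subst_term \<tau> t" by auto
      have "vdp s \<le> vdp t" unfolding t(2) by (rule Fun.IH) (use t Fun.prems in auto)
      then show ?thesis using vdp_arg[OF False t(1)] by simp
    qed
    have "vdp (Fun f (map (subst_term \<tau>) ts)) \<le> 1 + (vdp (Fun f ts) - 1)"
      by (rule vdp_Fun_le, erule le) (use vdp_nonground[OF False] in linarith)
    then show ?thesis by (simp del: vdp.simps)
  qed
qed simp

text \<open>Since \<open>x\<close> is itself an argument of \<open>t\<close>, its value is an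
  immediate argument of the instance. Groundness of \<open>\<sigma> x\<close> is excluded because
  ground terms have depth -1 at every level, so strictness could fail.\<close>

lemma vdp_subst_var_less:
  assumes "simple_term t" "compound t" "x \<in> vars t" "\<not> ground (\<sigma> x)"
  shows "vdp (\<sigma> x) < vdp (subst_term \<sigma> t)"
proof -
  obtain f ts where t: "t = Fun f ts" using assms(2) by (cases t) auto
  have "Var x \<in> set ts"
    by (rule simple_term_vars_arg[OF assms(1)[unfolded t] assms(3)[unfolded t]])
  then have "\<sigma> x \<in> set (map (subst_term \<sigma>) ts)" by force
  moreover have "\<not> ground (subst_term \<sigma> t)" using assms by (auto simp: ground_subst_iff)
  ultimately show ?thesis using vdp_arg t by fastforce
qed

text \<open>The arguments of \<open>s\<close> are ground or variables. Those with non-ground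
  instances are thus variables of \<open>t\<close>, and their values lie strictly below the instance
  of \<open>t\<close>. The depth of such an instance is governed by the variables alone, not by the
  root symbol.\<close>

lemma vdp_subst_simple_mono:
  assumes "simple_term s" "compound s" "simple_term t" "compound t" "vars s \<subseteq> vars t"
  shows "vdp (subst_term \<sigma> s) \<le> vdp (subst_term \<sigma> t)"
proof (cases "ground (subst_term \<sigma> s)")
  case True
  then show ?thesis by (simp add: vdp_ground vdp_ge)
next
  case False
  then have t_ng: "\<not> ground (subst_term \<sigma> t)" using assms by (auto simp: ground_subst_iff)
  obtain f ss where s: "s = Fun f ss" using assms(2) by (cases s) auto
  have le: "vdp u \<le> vdp (subst_term \<sigma> t) - 1" if "u \<in> set (map (subst_term \<sigma>) ss)" for u
  proof (cases "ground u")
    case True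
    then show ?thesis using vdp_nonground[OF t_ng] by (simp add: vdp_ground)
  next
    case False
    from that obtain w where w: "w \<in> set ss" "u = subst_term \<sigma> w" by auto
    have "flat_term w" by (rule simple_term_args_flat[OF assms(1)[unfolded s] w(1)])
    then show ?thesis
    proof (cases rule: flat_term_cases)
      case 1
      then show ?thesis using False w by (simp add: subst_term_ground)
    next
      case (2 x)
      then have "x \<in> vars t" using w s assms(5) by force
      then show ?thesis using vdp_subst_var_less[OF assms(3,4)] 2 w False by fastforce
    qed
  qed
  have "vdp (Fun f (map (subst_term \<sigma>) ss)) \<le> 1 + (vdp (subst_term \<sigma> t) - 1)"
    by (rule vdp_Fun_le, erule le) (use vdp_nonground[OF t_ng] in linarith)
  then show ?thesis by (simp add: s del: vdp.simps)
qed

section \<open>Atoms and weak covering\<close>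

lemma vars_arg_subset: "k < length (args A) \<Longrightarrow> vars (args A ! k) \<subseteq> vars_atom A"
  unfolding vars_atom_def by (intro UN_upper nth_mem)

lemma vars_subterms: "s \<in> subterms t \<Longrightarrow> vars s \<subseteq> vars t"
  by (induction t) auto

text \<open>The witness of \<open>nonground_compound_atom\<close> may be a nested subterm. The
  argument around it is neither ground nor a variable, which leaves only the covering
  alternative.\<close>

lemma nonground_compound_covering_arg:
  assumes "weakly_covering_atom B" "nonground_compound_atom B"
  obtains t where "t \<in> set (args B)" "\<not> ground t" "compound t" "vars t = vars_atom B"
proof -
  obtain t s where t: "t \<in> set (args B)" "s \<in> subterms t" "\<not> ground s" "compound s"
    using assms(2) by (auto simp: nonground_compound_atom_def)
  have "\<not> ground t" using vars_subterms[OF t(2)] t(3) by (auto simp: ground_def)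
  moreover have "\<not> is_variable t" by (insert t, cases t) auto
  ultimately have "weakly_covering_term t" "vars t = vars_atom B"
    using assms(1) t(1) by (auto simp: weakly_covering_atom_def)
  then show ?thesis using that t(1) \<open>\<not> ground t\<close> by (auto simp: weakly_covering_term_def)
qed

lemma subst_atom_eq_iff:
  "subst_atom \<sigma> A = subst_atom \<tau> B \<longleftrightarrow> pred_sym A = pred_sym B \<and> length (args A) = length (args B) \<and>
     (\<forall>k<length (args A). subst_term \<sigma> (args A ! k) = subst_term \<tau> (args B ! k))"
  by (cases A; cases B) (auto simp: list_eq_iff_nth_eq)

lemma subst_atom_cong:
  assumes "\<And>x. x \<in> vars_atom A \<Longrightarrow> \<sigma> x = \<tau> x"
  shows "subst_atom \<sigma> A = subst_atom \<tau> A"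
  unfolding subst_atom_eq_iff
  using assms vars_arg_subset by (blast intro: subst_term_cong)

lemma vars_atom_subst: "vars_atom (subst_atom \<sigma> A) = (\<Union>x\<in>vars_atom A. vars (\<sigma> x))"
  by (cases A) (auto simp: vars_atom_def vars_subst_term)

section \<open>Properties of most general unifiers\<close>

lemma is_mgu_instance:
  assumes "is_mgu \<tau> E" "unifier \<mu> E"
  obtains \<delta> where "\<And>x. \<mu> x = subst_term \<delta> (\<tau> x)"
  using assms unfolding is_mgu_def by metis

text \<open>Resetting \<open>x\<close> to itself leaves a unifier, because no equation mentions
  \<open>x\<close>. This unifier is an instance of \<open>\<tau>\<close>, and only a variable can be
  instantiated to \<open>Var x\<close>.\<close>

lemma is_mgu_fresh:
  assumes "is_mgu \<tau> E" "\<And>A B. (A, B) \<in> E \<Longrightarrow> x \<notin> vars_atom A \<and> x \<notin> vars_atom B"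
  shows "\<exists>y. \<tau> x = Var y"
proof -
  have "subst_atom (\<tau>(x := Var x)) A = subst_atom (\<tau>(x := Var x)) B" if "(A, B) \<in> E" for A B
  proof -
    have "subst_atom (\<tau>(x := Var x)) A = subst_atom \<tau> A" "subst_atom (\<tau>(x := Var x)) B = subst_atom \<tau> B"
      using assms(2)[OF that] by (auto intro!: subst_atom_cong)
    then show ?thesis using assms(1) that by (auto simp: is_mgu_def unifier_def)
  qed
  then have "unifier (\<tau>(x := Var x)) E" by (auto simp: unifier_def)
  from is_mgu_instance[OF assms(1) this] obtain \<delta>
    where "\<And>y. (\<tau>(x := Var x)) y = subst_term \<delta> (\<tau> y)" by blast
  from this[of x] have "subst_term \<delta> (\<tau> x) = Var x" by simp
  then show ?thesis by (rule subst_eq_VarD)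
qed

text \<open>Taking \<open>\<tau>\<close> on \<open>V\<close> and \<open>\<sigma>\<close> elsewhere
  gives a unifier of both parts, hence an instance of \<open>\<sigma>\<close>. Instantiation cannot
  change a ground value of \<open>\<sigma>\<close>, so on such variables the patched values from
  \<open>\<tau>\<close> coincide with it.\<close>

lemma is_mgu_ground_on_disjoint_part:
  assumes \<sigma>: "is_mgu \<sigma> (E \<union> F)" and \<tau>: "unifier \<tau> E"
    and V: "\<And>A B. (A, B) \<in> E \<Longrightarrow> vars_atom A \<union> vars_atom B \<subseteq> V"
    and W: "\<And>A B. (A, B) \<in> F \<Longrightarrow> (vars_atom A \<union> vars_atom B) \<inter> V = {}"
    and x: "x \<in> V" "ground (\<sigma> x)"
  shows "\<tau> x = \<sigma> x"
proof -
  define \<nu> where "\<nu> y = (if y \<in> V then \<tau> y else \<sigma> y)" for y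
  have "subst_atom \<nu> A = subst_atom \<nu> B" if "(A, B) \<in> E \<union> F" for A B
  proof (cases "(A, B) \<in> E")
    case True
    then have "subst_atom \<nu> A = subst_atom \<tau> A" "subst_atom \<nu> B = subst_atom \<tau> B"
      using V[OF True] by (auto intro!: subst_atom_cong simp: \<nu>_def)
    then show ?thesis using \<tau> True by (auto simp: unifier_def)
  next
    case False
    then have "subst_atom \<nu> A = subst_atom \<sigma> A" "subst_atom \<nu> B = subst_atom \<sigma> B"
      using W[of A B] that by (auto intro!: subst_atom_cong simp: \<nu>_def)
    then show ?thesis using \<sigma> that by (auto simp: unifier_def is_mgu_def)
  qed
  then have "unifier \<nu> (E \<union> F)" by (auto simp: unifier_def)
  from is_mgu_instance[OF \<sigma> this] obtain \<delta> where "\<And>y. \<nu> y = subst_term \<delta> (\<sigma> y)" by blast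
  from this[of x] show ?thesis using x by (simp add: \<nu>_def subst_term_ground split: if_splits)
qed

text \<open>Collapsing every non-ground value below the top level to one variable turns \<open>\<tau>\<close> into another
  unifier. Since that unifier is an instance of \<open>\<tau>\<close>, the collapsed values were variables already.\<close>

lemma is_mgu_layered_flat:
  fixes \<tau> :: "('f, 'v) subst" and E :: "(('p, 'f, 'v) atom \<times> ('p, 'f, 'v) atom) set"
  assumes \<tau>: "is_mgu \<tau> E"
    and layered: "\<And>A B k. (A, B) \<in> E \<Longrightarrow> k < length (args A) \<Longrightarrow>
        vars (args B ! k) \<inter> X = {} \<and>
        ((\<exists>x\<in>X. args A ! k = Var x) \<and> compound (args B ! k) \<and> simple_term (args B ! k) \<or>
         flat_term (args A ! k) \<and> vars (args A ! k) \<inter> X = {} \<and> flat_term (args B ! k))"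
    and x: "x \<notin> X"
  shows "vdp (\<tau> x) \<le> 0"
proof -
  define K :: "('f, 'v) trm \<Rightarrow> ('f, 'v) trm" where "K t = (if ground t then t else Var x)" for t
  \<comment> \<open>On \<open>X\<close> the root symbol is kept and only the arguments are
    collapsed: a value there must match an instance of a compound simple term, whose flat arguments
    are collapsed by \<open>\<mu>\<close> in the same way.\<close>
  define \<mu> where
    "\<mu> y = (if y \<in> X then (case \<tau> y of Var z \<Rightarrow> Var z | Fun f ts \<Rightarrow> Fun f (map K ts)) else K (\<tau> y))" for y
  have K_flat: "subst_term \<mu> t = K (subst_term \<tau> t)" if "flat_term t" "vars t \<inter> X = {}" for t
    using that(1) by (rule flat_term_cases) (use that(2) in \<open>auto simp: subst_term_ground K_def \<mu>_def\<close>)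
  have "subst_atom \<mu> A = subst_atom \<mu> B" if AB: "(A, B) \<in> E" for A B
  proof -
    have eq: "subst_atom \<tau> A = subst_atom \<tau> B" using \<tau> AB by (auto simp: is_mgu_def unifier_def)
    have "subst_term \<mu> (args A ! k) = subst_term \<mu> (args B ! k)" if k: "k < length (args A)" for k
    proof -
      have eqk: "subst_term \<tau> (args A ! k) = subst_term \<tau> (args B ! k)"
        using eq k by (auto simp: subst_atom_eq_iff)
      have disj: "vars (args B ! k) \<inter> X = {}" using layered[OF AB k] by blast
      consider y where "y \<in> X" "args A ! k = Var y" "compound (args B ! k)" "simple_term (args B ! k)"
        | "flat_term (args A ! k)" "vars (args A ! k) \<inter> X = {}" "flat_term (args B ! k)"
        using layered[OF AB k] by blast
      then show ?thesis
      proof cases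
        case 1
        obtain f ts where t: "args B ! k = Fun f ts" using 1 by (cases "args B ! k") auto
        have "subst_term \<mu> s = K (subst_term \<tau> s)" if "s \<in> set ts" for s
          using simple_term_args_flat[of f ts s] that 1 t disj by (intro K_flat) auto
        then show ?thesis using 1 t eqk by (simp add: \<mu>_def)
      next
        case 2
        then show ?thesis using K_flat disj eqk by metis
      qed
    qed
    then show ?thesis using eq by (auto simp: subst_atom_eq_iff)
  qed
  then have "unifier \<mu> E" by (auto simp: unifier_def)
  from is_mgu_instance[OF \<tau> this] obtain \<delta> where "\<And>y. \<mu> y = subst_term \<delta> (\<tau> y)" by blast
  from this[of x] have d: "subst_term \<delta> (\<tau> x) = K (\<tau> x)" using x by (simp add: \<mu>_def)
  show ?thesis
  proof (cases "ground (\<tau> x)")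
    case False
    then obtain y where "\<tau> x = Var y" using d subst_eq_VarD by (metis K_def)
    then show ?thesis by simp
  qed (simp add: vdp_ground)
qed

section \<open>Terms and depth of clauses\<close>

lemma terms_clause_plus: "terms_clause (C + D) = terms_clause C \<union> terms_clause D"
  by (auto simp: terms_clause_def)

lemma terms_clause_subst: "terms_clause (subst_clause \<tau> C) = subst_term \<tau> ` terms_clause C"
proof -
  have "args (atm (map_literal (subst_atom \<tau>) L)) = map (subst_term \<tau>) (args (atm L))"
    if "L \<in># C" for L
    by (cases L; cases "atm L") auto
  then show ?thesis by (simp add: terms_clause_def subst_clause_def image_UN)
qed

lemma vdp_le_depth_clause: "t \<in> terms_clause C \<Longrightarrow> vdp t \<le> depth_clause C"
  unfolding depth_clause_def terms_clause_def by (auto intro!: Max_ge)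

text \<open>The bound \<open>-1 \<le> k\<close> covers clauses without terms, whose depth is -1 by
  convention.\<close>

lemma depth_clause_le:
  assumes "\<And>t. t \<in> terms_clause C \<Longrightarrow> vdp t \<le> k" "-1 \<le> k"
  shows "depth_clause C \<le> k"
proof -
  have "finite (terms_clause C)" by (auto simp: terms_clause_def)
  then show ?thesis using assms by (auto simp: depth_clause_def)
qed

lemma depth_clause_ge: "-1 \<le> depth_clause C"
proof (cases "terms_clause C = {}")
  case False
  then obtain t where "t \<in> terms_clause C" by blast
  then show ?thesis using vdp_le_depth_clause vdp_ge order_trans by blast
qed (simp add: depth_clause_def)

lemma vars_terms_clause: "t \<in> terms_clause C \<Longrightarrow> vars t \<subseteq> vars_clause C"
  by (auto simp: terms_clause_def vars_clause_def vars_atom_def)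

section \<open>Depth of the resolvent\<close>

theorem theorem1:
  fixes As Bs :: "('p, 'f, 'v) atom list"
    and C D R :: "('p, 'f, 'v) clause"
    and Cs Ds :: "('p, 'f, 'v) clause list"
  assumes "query_pair_clauses As D Bs Ds C Cs"
    and "\<forall>C'\<in>set Cs. vars_clause C \<inter> vars_clause C' = {}"
    and "Res_resolvent As D Bs Ds R"
  shows "depth_clause R \<le> Max (depth_clause ` set (C # Cs))"
proof -
  define m where "m = Max (depth_clause ` set (C # Cs))"
  have qp: "query_pair As Bs" and lenD: "length Ds = length Bs" and D: "flat_clause D"
    and Ds: "\<And>D'. D' \<in> set Ds \<Longrightarrow> simple_clause D'"
    and C: "C = main_premise As D" and Cs: "Cs = map2 side_premise Bs Ds"
    using assms(1) by (auto simp: query_pair_clauses_def)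
  have len: "length As = length Bs"
    and wc: "\<And>B. B \<in> set Bs \<Longrightarrow> weakly_covering_atom B"
    and flatA: "\<And>A. A \<in> set As \<Longrightarrow> flat_atom A" and ngA: "vars_atoms As \<noteq> {}"
    and simpleB: "\<And>B. B \<in> set Bs \<Longrightarrow> simple_atom B"
    and ngcB: "\<And>B. B \<in> set Bs \<Longrightarrow> nonground_compound_atom B \<or> ground_atom B"
    and disjAB: "vars_atoms As \<inter> vars_atoms Bs = {}"
    and disjB: "\<And>i j. i < length Bs \<Longrightarrow> j < length Bs \<Longrightarrow> i \<noteq> j \<Longrightarrow>
        vars_atom (Bs ! i) \<inter> vars_atom (Bs ! j) = {}"
    using qp unfolding query_pair_def by blast+
  obtain \<sigma> \<tau> T where \<sigma>: "is_mgu \<sigma> (set (zip As Bs))" and T: "T = top_positions \<sigma> As"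
    and \<tau>: "is_mgu \<tau> ((\<lambda>i. (As ! i, Bs ! i)) ` T)"
    and R: "R = subst_clause \<tau>
        ((\<Sum>i\<in>T. Ds ! i) + {#Neg (As ! i). i \<in># mset_set ({..<length As} - T)#} + D)"
    using assms(3) unfolding Res_resolvent_def by blast
  let ?n = "length As"
  have T_less: "i < ?n" if "i \<in> T" for i using that T by (auto simp: top_positions_def)
  have finT: "finite T" using T_less by (meson finite_nat_set_iff_bounded)
  have Cs_nth: "Cs ! i = side_premise (Bs ! i) (Ds ! i)" "Cs ! i \<in> set Cs" if "i < ?n" for i
    using that len lenD unfolding Cs by (simp, intro nth_mem, simp)
  have \<sigma>_eq: "subst_atom \<sigma> (As ! i) = subst_atom \<sigma> (Bs ! i)" if "i < ?n" for i
  proof -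
    have "(As ! i, Bs ! i) \<in> set (zip As Bs)" using that len by (auto simp: set_zip)
    then show ?thesis using \<sigma> by (auto simp: is_mgu_def unifier_def)
  qed
  have varsA: "vars_atom (As ! i) \<subseteq> vars_atoms As" and varsB: "vars_atom (Bs ! i) \<subseteq> vars_atoms Bs"
    if "i < ?n" for i using that len unfolding vars_atoms_def
    by (intro UN_upper[where B = vars_atom] nth_mem; simp)+
  have varsA_C: "vars_atoms As \<subseteq> vars_clause C"
    by (auto simp: C main_premise_def vars_atoms_def vars_clause_def)

  have depth_m: "depth_clause C' \<le> m" if "C' \<in> set (C # Cs)" for C'
    using that unfolding m_def by (intro Max_ge) auto
  have m_ge: "-1 \<le> m" using depth_clause_ge[of C] depth_m[of C] by simp
  have vdp_C: "vdp t \<le> m" if "t \<in> terms_clause C" for t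
    using vdp_le_depth_clause[OF that] depth_m[of C] by simp
  have vdp_Cs: "vdp t \<le> m" if "t \<in> terms_clause (Cs ! i)" "i < ?n" for t i
    using vdp_le_depth_clause[OF that(1)] depth_m[of "Cs ! i"] Cs_nth[OF that(2)] by simp

  \<comment> \<open>\<open>D\<close> and the unselected negative literals stem from the flat part of
    \<open>C\<close>, while the selected \<open>Ds ! i\<close> are simple and stem from
    \<open>Cs ! i\<close>. So every term of \<open>R\<close> instantiates a premise term of one of
    these two kinds.\<close>
  have R_cases: thesis if "t \<in> terms_clause R"
    and main: "\<And>s. t = subst_term \<tau> s \<Longrightarrow> s \<in> terms_clause C \<Longrightarrow> flat_term s \<Longrightarrow> thesis"
    and side: "\<And>s i. t = subst_term \<tau> s \<Longrightarrow> i \<in> T \<Longrightarrow> s \<in> terms_clause (Cs ! i) \<Longrightarrow> simple_term s \<Longrightarrow> thesis"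
  for t thesis
  proof -
    obtain s where s: "t = subst_term \<tau> s" and "s \<in> terms_clause (\<Sum>i\<in>T. Ds ! i) \<or>
        s \<in> terms_clause {#Neg (As ! i). i \<in># mset_set ({..<?n} - T)#} \<or> s \<in> terms_clause D"
      using \<open>t \<in> terms_clause R\<close> unfolding R terms_clause_subst terms_clause_plus by blast
    then consider i where "i \<in> T" "s \<in> terms_clause (Ds ! i)" | i where "i < ?n" "s \<in> set (args (As ! i))"
      | "s \<in> terms_clause D"
      by (auto simp: terms_clause_def finT set_mset_sum)
    then show thesis
    proof cases
      case 1
      have "s \<in> terms_clause (Cs ! i)"
        using 1 Cs_nth T_less by (simp add: side_premise_def terms_clause_def)
      moreover have "simple_term s" using 1 T_less len lenD Ds[of "Ds ! i"] by (auto simp: simple_clause_def)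
      ultimately show ?thesis using side s 1 by blast
    next
      case 2
      then have mem: "As ! i \<in> set As" by simp
      have "s \<in> terms_clause C" using 2 mem by (force simp: C main_premise_def terms_clause_def)
      moreover have "flat_term s" using 2 flatA[OF mem] by (simp add: flat_atom_def)
      ultimately show ?thesis using main s by blast
    next
      case 3
      have "s \<in> terms_clause C" using 3 by (simp add: C main_premise_def terms_clause_plus)
      then show ?thesis using main s D 3 by (auto simp: flat_clause_def)
    qed
  qed

  have "vdp t \<le> m" if t: "t \<in> terms_clause R" for t
  proof (cases "\<forall>x\<in>vars_atoms As. ground (\<sigma> x)")
    case True
    \<comment> \<open>All values have depth -1 here, so every variable of \<open>As\<close> is a top
      variable and an unselected atom has no variable at all.\<close>
    have non_T: "vars_atom (As ! i) = {}" if "i < ?n" "i \<notin> T" for i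
    proof (rule ccontr)
      assume "vars_atom (As ! i) \<noteq> {}"
      then obtain x where x: "x \<in> vars_atom (As ! i)" by blast
      then have "top_variable \<sigma> As x"
        using True varsA[OF that(1)] by (auto simp: top_variable_def vdp_ground)
      then show False using x that T by (auto simp: top_positions_def)
    qed
    define E where "E = (\<lambda>i. (As ! i, Bs ! i)) ` T"
    define F where "F = (\<lambda>i. (As ! i, Bs ! i)) ` ({..<?n} - T)"
    define V where "V = (\<Union>i\<in>T. vars_atom (As ! i) \<union> vars_atom (Bs ! i))"
    have EF: "set (zip As Bs) = E \<union> F"
      using T_less len by (auto simp: E_def F_def set_zip)
    \<comment> \<open>An unselected \<open>As ! i\<close> is ground, and \<open>Bs ! i\<close>
      shares no variable with \<open>As\<close> or with any other member of
      \<open>Bs\<close>.\<close>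
    have F_disj: "(vars_atom A \<union> vars_atom B) \<inter> V = {}" if "(A, B) \<in> F" for A B
    proof -
      from that obtain i where i: "A = As ! i" "B = Bs ! i" "i < ?n" "i \<notin> T" by (auto simp: F_def)
      have "vars_atom B \<inter> vars_atom (As ! j) = {}" "vars_atom B \<inter> vars_atom (Bs ! j) = {}"
        if "j \<in> T" for j
        using varsA[OF T_less[OF that]] varsB[OF i(3)] disjAB disjB[of i j] i T_less[OF that] that len
        by auto
      then show ?thesis using non_T[OF i(3,4)] i by (auto simp: V_def)
    qed
    \<comment> \<open>The common instance of \<open>As ! i\<close> and \<open>Bs ! i\<close> is
      ground, so \<open>\<sigma>\<close> also grounds the variables of
      \<open>Bs ! i\<close>.\<close>
    have ground_V: "ground (\<sigma> x)" if "x \<in> V" for x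
    proof -
      obtain i where i: "i \<in> T" "x \<in> vars_atom (As ! i) \<or> x \<in> vars_atom (Bs ! i)"
        using \<open>x \<in> V\<close> by (auto simp: V_def)
      have "vars_atom (subst_atom \<sigma> (As ! i)) = {}"
        using True varsA[OF T_less[OF i(1)]] by (auto simp: vars_atom_subst ground_def)
      moreover from this have "vars_atom (subst_atom \<sigma> (Bs ! i)) = {}"
        using \<sigma>_eq[OF T_less[OF i(1)]] by simp
      ultimately show ?thesis using i by (auto simp: vars_atom_subst ground_def)
    qed
    \<comment> \<open>On \<open>V\<close> the values of \<open>\<tau>\<close> are the ground ones of
      \<open>\<sigma>\<close>; outside \<open>V\<close> they are variables. In this case
      \<open>\<tau>\<close> can therefore increase no depth.\<close>
    have flat: "vdp (\<tau> x) \<le> 0" for x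
    proof (cases "x \<in> V")
      case True
      have "\<tau> x = \<sigma> x"
      proof (rule is_mgu_ground_on_disjoint_part[where V = V])
        show "is_mgu \<sigma> (E \<union> F)" using \<sigma> EF by simp
        show "unifier \<tau> E" using \<tau> by (simp add: is_mgu_def E_def)
        show "(vars_atom A \<union> vars_atom B) \<inter> V = {}" if "(A, B) \<in> F" for A B
          using F_disj that .
      qed (use True ground_V in \<open>auto simp: E_def V_def\<close>)
      then show ?thesis using ground_V[OF True] by (simp add: vdp_ground)
    next
      case False
      then have "\<exists>y. \<tau> x = Var y" by (intro is_mgu_fresh[OF \<tau>]) (auto simp: V_def)
      then show ?thesis by auto
    qed
    from t show ?thesis
    proof (rule R_cases)
      fix s assume "t = subst_term \<tau> s" "s \<in> terms_clause C"
      then show ?thesis using vdp_subst_flat_le[of s \<tau>, OF flat] vdp_C[of s] by simp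
    next
      fix s i assume "t = subst_term \<tau> s" "i \<in> T" "s \<in> terms_clause (Cs ! i)"
      then show ?thesis using vdp_subst_flat_le[of s \<tau>, OF flat] vdp_Cs[of s i] T_less[of i] by simp
    qed
  next
    case False
    define X where "X = {x. top_variable \<sigma> As x}"
    have X_As: "X \<subseteq> vars_atoms As" by (auto simp: X_def top_variable_def)
    have X_max: "vdp (\<sigma> y) \<le> vdp (\<sigma> x)" if "x \<in> X" "y \<in> vars_atoms As" for x y
      using that by (auto simp: X_def top_variable_def)
    obtain y0 where y0: "y0 \<in> vars_atoms As" "\<not> ground (\<sigma> y0)" using False by blast
    have X_ng: "\<not> ground (\<sigma> x)" if "x \<in> X" for x
      using X_max[OF that y0(1)] y0(2) by (simp add: vdp_neg_iff[symmetric])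
    have T_X: "\<exists>x\<in>X. x \<in> vars_atom (As ! i)" if "i \<in> T" for i
      using that T by (auto simp: top_positions_def X_def)
    \<comment> \<open>Finiteness lets the maximal depth be attained, which provides a top variable
      \<open>x0\<close> and a selected position \<open>i0\<close>. The latter is used for the lower
      bound on \<open>m\<close>.\<close>
    have "vars_atoms As = (\<Union>A\<in>set As. \<Union>t\<in>set (args A). vars t)"
      by (simp add: vars_atoms_def vars_atom_def)
    moreover have "finite (vars u)" for u :: "('f, 'v) trm" by (induction u) auto
    ultimately have "finite (vars_atoms As)" by auto
    then have fin: "finite ((\<lambda>y. vdp (\<sigma> y)) ` vars_atoms As)" by simp
    then have "Max ((\<lambda>y. vdp (\<sigma> y)) ` vars_atoms As) \<in> (\<lambda>y. vdp (\<sigma> y)) ` vars_atoms As"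
      using ngA by (intro Max_in) auto
    then obtain x0 where x0: "x0 \<in> vars_atoms As" "Max ((\<lambda>y. vdp (\<sigma> y)) ` vars_atoms As) = vdp (\<sigma> x0)"
      by blast
    then have "\<forall>y\<in>vars_atoms As. vdp (\<sigma> y) \<le> vdp (\<sigma> x0)"
      using Max_ge[OF fin] by auto
    then have "x0 \<in> X" using x0(1) by (simp add: X_def top_variable_def)
    from x0(1) obtain i0 where i0: "i0 < ?n" "x0 \<in> vars_atom (As ! i0)"
      by (auto simp: vars_atoms_def in_set_conv_nth)
    then have "i0 \<in> T" using \<open>x0 \<in> X\<close> T by (auto simp: top_positions_def X_def)

    \<comment> \<open>The value of a top variable is non-ground, so the common instance is too.
      Hence \<open>Bs ! i\<close> is not ground and must be a non-ground compound atom.\<close>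
    have covering: thesis if "i \<in> T"
      and "\<And>t. t \<in> set (args (Bs ! i)) \<Longrightarrow> \<not> ground t \<Longrightarrow> compound t \<Longrightarrow> vars t = vars_atom (Bs ! i) \<Longrightarrow> thesis"
      for i thesis
    proof -
      have i: "i < ?n" using T_less that(1) .
      have mem: "Bs ! i \<in> set Bs" using i len by simp
      obtain x where x: "x \<in> X" "x \<in> vars_atom (As ! i)" using T_X[OF \<open>i \<in> T\<close>] by blast
      then have "vars_atom (subst_atom \<sigma> (As ! i)) \<noteq> {}"
        using X_ng[OF x(1)] by (auto simp: vars_atom_subst ground_def)
      then have "\<not> ground_atom (Bs ! i)"
        using \<sigma>_eq[OF i] by (auto simp: vars_atom_subst ground_atom_def)
      then show thesis
        using ngcB[OF mem] nonground_compound_covering_arg[OF wc[OF mem]] that(2) by blast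
    qed

    \<comment> \<open>This supplies the hypothesis of \<open>is_mgu_layered_flat\<close>, with the
      top variables as upper layer \<open>X\<close>.\<close>
    have layer: "vars (args (Bs ! i) ! k) \<inter> X = {} \<and>
        ((\<exists>x\<in>X. args (As ! i) ! k = Var x) \<and> compound (args (Bs ! i) ! k) \<and> simple_term (args (Bs ! i) ! k) \<or>
         flat_term (args (As ! i) ! k) \<and> vars (args (As ! i) ! k) \<inter> X = {} \<and> flat_term (args (Bs ! i) ! k))"
      if i: "i \<in> T" and k: "k < length (args (As ! i))" for i k
    proof -
      let ?A = "As ! i" and ?B = "Bs ! i"
      have i_n: "i < ?n" using T_less i .
      have memB: "?B \<in> set Bs" and memA: "?A \<in> set As" using i_n len by simp_all
      have lenAB: "length (args ?A) = length (args ?B)"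
        and eq: "\<And>l. l < length (args ?A) \<Longrightarrow> subst_term \<sigma> (args ?A ! l) = subst_term \<sigma> (args ?B ! l)"
        using \<sigma>_eq[OF i_n] by (auto simp: subst_atom_eq_iff)
      have flat: "flat_term (args ?A ! l)" if "l < length (args ?A)" for l
        using flatA[OF memA] that by (simp add: flat_atom_def)
      have simp_B: "simple_term u" if "u \<in> set (args ?B)" for u
        using simpleB[OF memB] that by (simp add: simple_atom_def)
      have vars_A_l: "vars (args ?A ! l) \<subseteq> vars_atom ?A" if "l < length (args ?A)" for l
        using vars_arg_subset[OF that] .
      have vars_B_l: "vars (args ?B ! l) \<subseteq> vars_atom ?B" if "l < length (args ?A)" for l
        using that lenAB by (intro vars_arg_subset) simp
      obtain x where x: "x \<in> X" "x \<in> vars_atom ?A" using T_X[OF i] by blast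
      have B_ng: "\<exists>z\<in>vars_atom ?B. \<not> ground (\<sigma> z)"
      proof -
        have "vars_atom (subst_atom \<sigma> ?A) \<noteq> {}" using x(2) X_ng[OF x(1)] by (auto simp: vars_atom_subst ground_def)
        then show ?thesis using \<sigma>_eq[OF i_n] by (auto simp: vars_atom_subst ground_def)
      qed
      \<comment> \<open>An argument of \<open>?B\<close> carrying all its variables stays non-ground
        under \<open>\<sigma>\<close>; the flat argument opposite it can then only be a
        variable.\<close>
      have cov_partner: "\<exists>y\<in>vars_atoms As. args ?A ! l = Var y"
        if l: "l < length (args ?A)" and cov: "vars (args ?B ! l) = vars_atom ?B" for l
        using flat[OF l]
      proof (cases rule: flat_term_cases)
        case 1
        then have "ground (subst_term \<sigma> (args ?B ! l))" using eq[OF l] by (metis subst_term_ground)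
        then show ?thesis using B_ng cov by (auto simp: ground_subst_iff)
      next
        case (2 y)
        then show ?thesis using vars_A_l[OF l] varsA[OF i_n] by auto
      qed
      obtain t where t: "t \<in> set (args ?B)" "\<not> ground t" "compound t" "vars t = vars_atom ?B"
        using covering[OF i] by blast
      then obtain l where l: "l < length (args ?A)" "args ?B ! l = t"
        using lenAB by (metis in_set_conv_nth)
      obtain y where y: "y \<in> vars_atoms As" "args ?A ! l = Var y" using cov_partner[OF l(1)] l t by blast
      have y_t: "\<sigma> y = subst_term \<sigma> t" using eq[OF l(1)] y l by simp
      have B_shape: "ground u \<or> is_variable u \<or> compound u \<and> vars u = vars_atom ?B"
        if "u \<in> set (args ?B)" for u
        using wc[OF memB] that by (auto simp: weakly_covering_atom_def weakly_covering_term_def)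
      \<comment> \<open>If a top variable faced a variable \<open>z\<close> of \<open>?B\<close>,
        then \<open>z\<close> would occur in the covering argument \<open>t\<close>. Its value would
        be strictly shallower than that of \<open>y\<close>, the partner of \<open>t\<close>,
        against maximality.\<close>
      have X_partner: "compound (args ?B ! k') \<and> vars (args ?B ! k') = vars_atom ?B"
        if k': "k' < length (args ?A)" and x': "args ?A ! k' = Var x'" "x' \<in> X" for k' x'
      proof -
        have u: "args ?B ! k' \<in> set (args ?B)" using k' lenAB by simp
        have e: "\<sigma> x' = subst_term \<sigma> (args ?B ! k')" using eq[OF k'] x' by simp
        have "\<not> ground (args ?B ! k')" using e X_ng[OF x'(2)] by (metis subst_term_ground)
        moreover have "\<not> is_variable (args ?B ! k')"
        proof
          assume "is_variable (args ?B ! k')"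
          then obtain z where z: "args ?B ! k' = Var z" by (cases "args ?B ! k'") auto
          then have "z \<in> vars t" using vars_B_l[OF k'] t by auto
          then have "vdp (\<sigma> z) < vdp (\<sigma> y)"
            using vdp_subst_var_less[OF simp_B[OF t(1)] t(3)] e z X_ng[OF x'(2)] y_t by simp
          then show False using X_max[OF x'(2) y(1)] e z by simp
        qed
        ultimately show ?thesis using B_shape[OF u] by blast
      qed
      have kB: "args ?B ! k \<in> set (args ?B)" using k lenAB by simp
      have disj: "vars (args ?B ! k) \<inter> X = {}"
        using vars_B_l[OF k] varsB[OF i_n] X_As disjAB by blast
      show ?thesis
      proof (cases "\<exists>x'\<in>X. args ?A ! k = Var x'")
        case True
        then show ?thesis using X_partner[OF k] simp_B[OF kB] disj by blast
      next
        case no_top: False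
        have "vars (args ?A ! k) \<inter> X = {}"
          using flat[OF k] by (rule flat_term_cases) (use no_top in \<open>auto simp: ground_def\<close>)
        moreover have "flat_term (args ?B ! k)"
        proof (rule ccontr)
          \<comment> \<open>A non-flat argument is covering, so its partner is a variable
            \<open>w\<close>. The top variable \<open>x\<close> of \<open>?A\<close> also faces a
            compound covering argument, and two such arguments with the same variables have
            instances of comparable depth; so \<open>w\<close> would be a top variable as
            well.\<close>
          assume nf: "\<not> flat_term (args ?B ! k)"
          then have "\<not> ground (args ?B ! k)" "\<not> is_variable (args ?B ! k)"
            by (auto simp: flat_term_def vdp_ground) (cases "args ?B ! k"; simp)
          then have cov: "compound (args ?B ! k)" "vars (args ?B ! k) = vars_atom ?B"
            using B_shape[OF kB] by blast+
          obtain w where w: "w \<in> vars_atoms As" "args ?A ! k = Var w" using cov_partner[OF k cov(2)] by blast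
          obtain p where p: "p < length (args ?A)" "x \<in> vars (args ?A ! p)"
            using x(2) by (auto simp: vars_atom_def in_set_conv_nth)
          have px: "args ?A ! p = Var x"
            using flat[OF p(1)] by (rule flat_term_cases) (use p in \<open>auto simp: ground_def\<close>)
          have pB: "args ?B ! p \<in> set (args ?B)" using p lenAB by simp
          have "vdp (\<sigma> x) \<le> vdp (\<sigma> w)"
            using vdp_subst_simple_mono[of "args ?B ! p" "args ?B ! k" \<sigma>] X_partner[OF p(1) px x(1)]
              cov simp_B[OF kB] simp_B[OF pB] eq[OF k] eq[OF p(1)] px w by simp
          then have "w \<in> X" using X_max[OF x(1)] w by (auto simp: X_def top_variable_def intro: order_trans)
          then show False using no_top w by blast
        qed
        ultimately show ?thesis using flat[OF k] disj by blast
      qed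
    qed

    have flat: "vdp (\<tau> x) \<le> 0" if "x \<notin> X" for x
      by (rule is_mgu_layered_flat[OF \<tau> _ that]) (use layer in auto)
    \<comment> \<open>The value of \<open>x\<close> is an instance of the simple argument
      \<open>?b\<close> opposite it, and \<open>?b\<close> contains only variables outside
      \<open>X\<close>, where \<open>\<tau>\<close> is flat.\<close>
    have top: "vdp (\<tau> x) \<le> 1" if "x \<in> X" for x
    proof -
      have "x \<in> vars_atoms As" using that X_As by blast
      then obtain i where i: "i < ?n" "x \<in> vars_atom (As ! i)"
        by (auto simp: vars_atoms_def in_set_conv_nth)
      then have iT: "i \<in> T" using that T by (auto simp: top_positions_def X_def)
      obtain k where k: "k < length (args (As ! i))" "x \<in> vars (args (As ! i) ! k)"
        using i by (auto simp: vars_atom_def in_set_conv_nth)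
      let ?b = "args (Bs ! i) ! k"
      have b: "args (As ! i) ! k = Var x" "simple_term ?b" "vars ?b \<inter> X = {}"
        using layer[OF iT k(1)] k(2) that by auto
      have "subst_atom \<tau> (As ! i) = subst_atom \<tau> (Bs ! i)"
        using \<tau> iT by (auto simp: is_mgu_def unifier_def)
      then have "\<tau> x = subst_term \<tau> ?b" using k b by (auto simp: subst_atom_eq_iff)
      moreover have "vdp (subst_term \<tau> ?b) \<le> vdp ?b" by (rule vdp_subst_flat_le) (use b flat in blast)
      ultimately show ?thesis using b(2) by (simp add: simple_term_def)
    qed
    \<comment> \<open>A selected side premise has a non-ground compound argument, so the premises
      already reach depth 1; this absorbs the values of the top variables.\<close>
    have m1: "1 \<le> m"
    proof -
      obtain b where b: "b \<in> set (args (Bs ! i0))" "\<not> ground b" "compound b"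
        using covering[OF \<open>i0 \<in> T\<close>] by blast
      have "b \<in> terms_clause (Cs ! i0)"
        using b Cs_nth[OF i0(1)] by (simp add: side_premise_def terms_clause_def)
      moreover have "1 \<le> vdp b"
      proof (rule ccontr)
        assume "\<not> 1 \<le> vdp b"
        then have "flat_term b" by (simp add: flat_term_def)
        then show False by (rule flat_term_cases) (use b in auto)
      qed
      ultimately show ?thesis using vdp_Cs[OF _ i0(1)] by fastforce
    qed
    from t show ?thesis
    proof (rule R_cases)
      fix s assume s: "t = subst_term \<tau> s" "flat_term s"
      from s(2) show ?thesis
      proof (cases rule: flat_term_cases)
        case 1
        then show ?thesis using s m_ge by (simp add: subst_term_ground vdp_ground)
      next
        case (2 x)
        then show ?thesis using s flat[of x] top[of x] m1 by force
      qed
    next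
      fix s i assume s: "t = subst_term \<tau> s" "i \<in> T" "s \<in> terms_clause (Cs ! i)" "simple_term s"
      \<comment> \<open>Disjointness of \<open>C\<close> from the side premises keeps top variables
        out of these terms; below a function symbol, a value of depth 1 could produce depth
        2.\<close>
      have "vars s \<inter> X = {}"
        using vars_terms_clause[OF s(3)] X_As varsA_C assms(2) Cs_nth(2)[OF T_less[OF s(2)]] by blast
      then have "vdp t \<le> vdp s" unfolding s(1) by (intro vdp_subst_flat_le flat) auto
      then show ?thesis using s(4) m1 by (simp add: simple_term_def)
    qed
  qed
  then show ?thesis unfolding m_def[symmetric] using m_ge by (rule depth_clause_le)
qed

end
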